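(* Let $\mathcal{K}\subset\mathbb{R}^d$ be convex and compact with set of extreme points $\mathcal{V}$, and let $f$ be convex and $\beta$-smooth over $\mathcal{K}$. Let $(\mathbf{x}_t)_{t\ge 1}$ be any sequence of iterates produced by the Frank-Wolfe algorithm with nearest extreme point oracle (described in the context) with $\eta_t=\frac{2}{t+1}$ for all $t\ge 1$. Then $$\forall t\ge 2:\quad f(\mathbf{x}_t)-f^*\le \frac{2\beta\left({D^*}^2+D_L^2\right)}{t+1}.$$ Moreover, if $f$ has the quadratic growth property over $\mathcal{K}$ with parameter $\alpha>0$, then $$\forall t\ge 2:\quad f(\mathbf{x}_t)-f^*\le \frac{2\beta {D^*}^2}{t+1}+\frac{\frac{8\beta^2}{\alpha}\left({D^*}^2+\min\{2\alpha^{-1}(f(\mathbf{x}_1)-f^* ),\,D_L^2\}\right)\log(t)}{t^2}.$$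
   Context: $\|\cdot\|$ is the Euclidean norm on $\mathbb{R}^d$, and $\mathrm{dist}(\mathbf{x},\mathcal S)$ is the Euclidean distance. $\beta$-smooth over $\mathcal{K}$: $f$ is differentiable on a neighbourhood of $\mathcal{K}$ and $\|\nabla f(\mathbf{x})-\nabla f(\mathbf{y})\|\le\beta\|\mathbf{x}-\mathbf{y}\|$ for all $\mathbf{x},\mathbf{y}\in\mathcal{K}$ ($\beta>0$). $f^*=\min_{\mathbf{x}\in\mathcal{K}}f(\mathbf{x})$ and $\mathcal{X}^*=\arg\min_{\mathbf{x}\in\mathcal{K}}f(\mathbf{x})$. $S^*\in\arg\min_{S\subseteq\mathcal{V}}\{\max_{\mathbf{u},\mathbf{v}\in S}\|\mathbf{v}-\mathbf{u}\| : \mathcal{X}^*\subseteq\mathrm{conv}(S)\}$, i.e. $S^*$ is a set of extreme points of minimum diameter whose convex hull contains $\mathcal{X}^*$ (the minima and maxima are assumed to be attained), and $D^*=\max_{\mathbf{u},\mathbf{v}\in S^*}\|\mathbf{v}-\mathbf{u}\|$. $D_L=\max\{\|\mathbf{u}-\mathbf{v}\| : \mathbf{u},\mathbf{v}\in\mathcal{K},\ f(\mathbf{u})\le f(\mathbf{x}_1),\ f(\mathbf{v})\le f(\mathbf{x}_1)\}$ is the diameter of the initial level set. Quadratic growth with parameter $\alpha>0$: $\mathrm{dist}(\mathbf{x},\mathcal{X}^* )^2\le 2\alpha^{-1}(f(\mathbf{x})-f^* )$ for all $\mathbf{x}\in\mathcal{K}$. Frank-Wolfe with nearest extreme point oracle,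 with step-sizes $\{\eta_t\}_{t\ge1}\subset[0,1]$: $\mathbf{x}_1\in\mathcal{V}$ is arbitrary; for $t=1,2,\dots$: (i) $\mathbf{v}_t\in\arg\min_{\mathbf{v}\in\mathcal{V}}\ \mathbf{v}^\top\nabla f(\mathbf{x}_t)+\frac{\beta\eta_t}{2}\|\mathbf{x}_t-\mathbf{v}\|^2$ (a minimizer is assumed to exist); (ii) pick any $\tilde\eta_t\in[0,1]$ such that $f((1-\tilde\eta_t)\mathbf{x}_t+\tilde\eta_t\mathbf{v}_t)\le\min\{f((1-\eta_t)\mathbf{x}_t+\eta_t\mathbf{v}_t),\,f(\mathbf{x}_t)\}$; (iii) $\mathbf{x}_{t+1}=(1-\tilde\eta_t)\mathbf{x}_t+\tilde\eta_t\mathbf{v}_t$.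
   Formalization: With the natural logarithm the second bound can fail at t = 2 (there is a counterexample with affine f on a triangle), so log(t) is read as the binary logarithm for all t ≥ 2, and the natural-logarithm bound is proved for all t ≥ 3. *)

theory Defs
  imports "HOL-Analysis.Analysis"
begin

text \<open>The vector representing the derivative; meaningful only where \<open>f\<close> is differentiable.\<close>

definition gradient :: "('a::euclidean_space \<Rightarrow> real) \<Rightarrow> 'a \<Rightarrow> 'a" where
  "gradient f x = (THE D. GDERIV f x :> D)"

definition smooth_over :: "'a::euclidean_space set \<Rightarrow> real \<Rightarrow> ('a \<Rightarrow> real) \<Rightarrow> bool" where
  "smooth_over K \<beta> f \<longleftrightarrow>
     \<beta> > 0 \<and>
     (\<exists>U. open U \<and> K \<subseteq> U \<and> (\<forall>x\<in>U. f differentiable (at x))) \<and>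
     (\<forall>x\<in>K. \<forall>y\<in>K. norm (gradient f x - gradient f y) \<le> \<beta> * norm (x - y))"

text \<open>For continuous \<open>f\<close> and nonempty compact \<open>K\<close> the infimum is attained.\<close>

definition min_value :: "'a::euclidean_space set \<Rightarrow> ('a \<Rightarrow> real) \<Rightarrow> real" where
  "min_value K f = (INF x\<in>K. f x)"

definition argmin_set :: "'a::euclidean_space set \<Rightarrow> ('a \<Rightarrow> real) \<Rightarrow> 'a set" where
  "argmin_set K f = {x. is_arg_min f (\<lambda>y. y \<in> K) x}"

definition extreme_points :: "'a::euclidean_space set \<Rightarrow> 'a set" where
  "extreme_points K = {v. v extreme_point_of K}"

text \<open>
  \<open>diameter\<close> is a supremum of distances; it is the maximum whenever that maximum is attained.
\<close>

definition min_diameter_support :: "'a::euclidean_space set \<Rightarrow> ('a \<Rightarrow> real) \<Rightarrow> 'a set \<Rightarrow> bool" where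
  "min_diameter_support K f S \<longleftrightarrow>
     is_arg_min diameter (\<lambda>T. T \<subseteq> extreme_points K \<and> argmin_set K f \<subseteq> convex hull T) S"

definition level_diameter :: "'a::euclidean_space set \<Rightarrow> ('a \<Rightarrow> real) \<Rightarrow> 'a \<Rightarrow> real" where
  "level_diameter K f x1 = diameter {u \<in> K. f u \<le> f x1}"

definition quadratic_growth :: "'a::euclidean_space set \<Rightarrow> real \<Rightarrow> ('a \<Rightarrow> real) \<Rightarrow> bool" where
  "quadratic_growth K \<alpha> f \<longleftrightarrow>
     \<alpha> > 0 \<and>
     (\<forall>x\<in>K. (infdist x (argmin_set K f))\<^sup>2 \<le> 2 / \<alpha> * (f x - min_value K f))"

text \<open>
  The iterates are \<open>x 1, x 2, \<dots>\<close>; the value \<open>x 0\<close> is irrelevant.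
  In each step \<open>v\<close> is the oracle answer and \<open>\<gamma>\<close> the step-size actually taken.
\<close>

definition nep_frank_wolfe ::
  "'a::euclidean_space set \<Rightarrow> ('a \<Rightarrow> real) \<Rightarrow> real \<Rightarrow> (nat \<Rightarrow> real) \<Rightarrow> (nat \<Rightarrow> 'a) \<Rightarrow> bool" where
  "nep_frank_wolfe K f \<beta> \<eta> x \<longleftrightarrow>
     (\<forall>t\<ge>1. \<eta> t \<in> {0..1}) \<and>
     x 1 \<in> extreme_points K \<and>
     (\<forall>t\<ge>1. \<exists>v \<gamma>.
        is_arg_min
          (\<lambda>u. u \<bullet> gradient f (x t) + \<beta> * \<eta> t / 2 * (norm (x t - u))\<^sup>2)
          (\<lambda>u. u \<in> extreme_points K) v \<and>
        \<gamma> \<in> {0..1} \<and>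
        f ((1 - \<gamma>) *\<^sub>R x t + \<gamma> *\<^sub>R v)
          \<le> min (f ((1 - \<eta> t) *\<^sub>R x t + \<eta> t *\<^sub>R v)) (f (x t)) \<and>
        x (Suc t) = (1 - \<gamma>) *\<^sub>R x t + \<gamma> *\<^sub>R v)"

text \<open>
  Base of the logarithm in the rate under quadratic growth. The natural logarithm is too small
  at \<open>t = 2\<close>: on the triangle with vertices \<open>(0,0)\<close>, \<open>(1,0)\<close>, \<open>(0.1,0.01)\<close>, take
  \<open>f (a,b) = 10 a - 91 b\<close>, \<open>\<beta> = 1\<close>, \<open>\<alpha> = 17.8\<close> and \<open>x 1 = (1,0)\<close>. The unique oracle answer is
  \<open>(0.1,0.01)\<close>, so with the full step \<open>x 2 = (0.1,0.01)\<close> and \<open>f (x 2) - min = 0.09\<close>; the support has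
  diameter 0, the level set has diameter 1, and the bound at \<open>t = 2\<close> is
  \<open>(8 / 17.8) * ln 2 / 4 < 0.078\<close>. The rate is therefore stated with the binary logarithm for all
  \<open>t \<ge> 2\<close>, and with the (smaller) natural logarithm from \<open>t = 3\<close> on.
\<close>

end

theory Submission
  imports Defs
begin

text \<open>
  Write a minimizer as a convex combination of points of \<open>S\<close>. Averaging the oracle inequality over
  this combination costs only its variance, which is at most half the squared diameter \<open>D\<close> of
  \<open>S\<close>, so the descent lemma yields
  \<open>h (t + 1) \<le> (1 - \<eta>) h t + \<beta> \<eta>\<^sup>2 / 2 (D\<^sup>2 / 2 + d\<^sup>2)\<close> for \<open>\<eta> = 2 / (t + 1)\<close>, where \<open>h t\<close>
  is the error and \<open>d\<close> the distance of the iterate to the minimizers. Bounding \<open>d\<close> by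
  the level diameter gives the first rate. Under quadratic growth the first rate bounds \<open>d\<close> for
  \<open>t \<ge> 2\<close>, and summing the recursion multiplied by \<open>t (t + 1)\<close> gives the logarithm. The first
  step is special, as \<open>d\<close> is not yet small there: its error is bounded by applying the oracle
  inequality to both the minimizer nearest to \<open>x 1\<close> and the one nearest to the oracle answer, and
  by comparing gradients at these points through cocoercivity.
\<close>

subsection \<open>Gradients and variance\<close>

text \<open>The vector of values on the basis represents the derivative; its uniqueness lets the
  definite description in \<open>gradient\<close> pick it.\<close>

lemma GDERIV_gradient:
  fixes f :: "'a::euclidean_space \<Rightarrow> real"
  assumes "f differentiable (at x)"
  shows "GDERIV f x :> gradient f x"
proof -
  obtain f' where f': "(f has_derivative f') (at x)"
    using assms unfolding differentiable_def by blast
  then interpret bounded_linear f' by (rule has_derivative_bounded_linear)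
  have "f' = (\<lambda>h. h \<bullet> (\<Sum>b\<in>Basis. f' b *\<^sub>R b))"
  proof
    fix h
    have "f' h = f' (\<Sum>b\<in>Basis. (h \<bullet> b) *\<^sub>R b)" by (simp add: euclidean_representation)
    also have "\<dots> = h \<bullet> (\<Sum>b\<in>Basis. f' b *\<^sub>R b)"
      by (simp add: sum scaleR inner_sum_right mult.commute)
    finally show "f' h = h \<bullet> (\<Sum>b\<in>Basis. f' b *\<^sub>R b)" .
  qed
  then have D: "GDERIV f x :> (\<Sum>b\<in>Basis. f' b *\<^sub>R b)"
    using f' unfolding gderiv_def by simp
  have "D' = D''" if "GDERIV f x :> D'" "GDERIV f x :> D''" for D' D''
    using has_derivative_unique[OF that[unfolded gderiv_def]]
    by (metis inner_commute vector_eq_rdot)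
  then show ?thesis unfolding gradient_def using D by (metis the_equality)
qed

text \<open>The parallel axis identity: \<open>z\<close> is the barycentre, so the cross terms
  cancel.\<close>

lemma weighted_sum_sq_dist:
  fixes z p :: "'a::real_inner"
  assumes "sum u T = 1" and "(\<Sum>s\<in>T. u s *\<^sub>R s) = z"
  shows "(\<Sum>s\<in>T. u s * (norm (s - p))\<^sup>2) = (\<Sum>s\<in>T. u s * (norm (s - z))\<^sup>2) + (norm (z - p))\<^sup>2"
proof -
  have eq: "(norm (s - p))\<^sup>2 = (norm (s - z))\<^sup>2 + 2 * (s \<bullet> (z - p)) - 2 * (z \<bullet> (z - p)) + (norm (z - p))\<^sup>2"
    for s unfolding power2_norm_eq_inner by (simp add: algebra_simps inner_commute)
  have "(\<Sum>s\<in>T. u s * (norm (s - p))\<^sup>2)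
      = (\<Sum>s\<in>T. u s * (norm (s - z))\<^sup>2 + 2 * ((u s *\<^sub>R s) \<bullet> (z - p))
          + u s * ((norm (z - p))\<^sup>2 - 2 * (z \<bullet> (z - p))))"
    by (intro sum.cong refl, subst eq) (simp add: algebra_simps)
  also have "\<dots> = (\<Sum>s\<in>T. u s * (norm (s - z))\<^sup>2) + 2 * ((\<Sum>s\<in>T. u s *\<^sub>R s) \<bullet> (z - p))
          + sum u T * ((norm (z - p))\<^sup>2 - 2 * (z \<bullet> (z - p)))"
    by (simp add: sum.distrib sum_distrib_left sum_distrib_right inner_sum_left)
  finally show ?thesis using assms by simp
qed

text \<open>Two independent draws from the weights \<open>u\<close> have mean squared distance twice
  the variance, and no pair is farther apart than the diameter; this is where the factor one half
  arises.\<close>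

lemma convex_hull_small_variance:
  fixes z :: "'a::euclidean_space"
  assumes "z \<in> convex hull S" and "bounded S"
  obtains T u where "finite T" "T \<subseteq> S" "\<forall>s\<in>T. 0 \<le> u s" "sum u T = 1"
    "(\<Sum>s\<in>T. u s *\<^sub>R s) = z" "(\<Sum>s\<in>T. u s * (norm (s - z))\<^sup>2) \<le> (diameter S)\<^sup>2 / 2"
proof -
  obtain T u where T: "finite T" "T \<subseteq> S" "\<forall>s\<in>T. 0 \<le> u s" "sum u T = 1"
    "(\<Sum>s\<in>T. u s *\<^sub>R s) = z"
    using assms(1) unfolding convex_hull_explicit by blast
  define V where "V = (\<Sum>s\<in>T. u s * (norm (s - z))\<^sup>2)"
  have le: "V + (norm (z - p))\<^sup>2 \<le> (diameter S)\<^sup>2" if "p \<in> T" for p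
  proof -
    have "V + (norm (z - p))\<^sup>2 = (\<Sum>s\<in>T. u s * (norm (s - p))\<^sup>2)"
      using weighted_sum_sq_dist[OF T(4,5), of p] V_def by simp
    also have "\<dots> \<le> (\<Sum>s\<in>T. u s * (diameter S)\<^sup>2)"
    proof (intro sum_mono mult_left_mono power_mono)
      fix s assume "s \<in> T"
      then show "norm (s - p) \<le> diameter S"
        using diameter_bounded_bound[OF assms(2), of s p] T(2) that by (auto simp: dist_norm)
    qed (use T(3) in auto)
    also have "\<dots> = (diameter S)\<^sup>2" using T(4) by (simp flip: sum_distrib_right)
    finally show ?thesis .
  qed
  have "(\<Sum>p\<in>T. u p * (V + (norm (p - z))\<^sup>2)) \<le> (\<Sum>p\<in>T. u p * (diameter S)\<^sup>2)"
    using le T(3) by (intro sum_mono mult_left_mono) (auto simp: norm_minus_commute)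
  moreover have "(\<Sum>p\<in>T. u p * (V + (norm (p - z))\<^sup>2)) = V + V"
    by (simp add: distrib_left sum.distrib V_def T(4) flip: sum_distrib_right)
  ultimately have "V \<le> (diameter S)\<^sup>2 / 2" using T(4) by (simp flip: sum_distrib_right)
  then show ?thesis using that[OF T] V_def by blast
qed

subsection \<open>Smooth convex functions on a convex set\<close>

locale smooth_convex =
  fixes K :: "'a::euclidean_space set" and f :: "'a \<Rightarrow> real" and \<beta> :: real
  assumes convex_f: "convex_on K f" and smooth: "smooth_over K \<beta> f"
begin

abbreviation g :: "'a \<Rightarrow> 'a" where "g \<equiv> gradient f"

lemma beta_pos: "\<beta> > 0" using smooth unfolding smooth_over_def by simp

lemma convex_K: "convex K" using convex_f by (rule convex_on_imp_convex)

lemma gradient_Lipschitz: "x \<in> K \<Longrightarrow> y \<in> K \<Longrightarrow> norm (g x - g y) \<le> \<beta> * norm (x - y)"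
  using smooth unfolding smooth_over_def by simp

lemma has_derivative_gradient: "x \<in> K \<Longrightarrow> (f has_derivative (\<lambda>h. h \<bullet> g x)) (at x)"
  using smooth GDERIV_gradient unfolding smooth_over_def gderiv_def by blast

lemma continuous_f: "continuous_on K f"
  using has_derivative_gradient
  by (meson continuous_at_imp_continuous_on has_derivative_continuous)

lemma continuous_gradient: "continuous_on K g"
proof -
  have "\<beta>-lipschitz_on K g"
    using gradient_Lipschitz beta_pos by (auto simp: lipschitz_on_def dist_norm)
  then show ?thesis by (rule lipschitz_on_continuous_on)
qed

lemma segment_mem:
  assumes "a \<in> K" "b \<in> K" "0 \<le> t" "t \<le> (1::real)"
  shows "a + t *\<^sub>R (b - a) \<in> K"
  using convexD_alt[OF convex_K assms] by (simp add: algebra_simps)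

lemma DERIV_along_segment:
  assumes "a \<in> K" "b \<in> K" "0 \<le> t" "t \<le> 1"
  shows "((\<lambda>t. f (a + t *\<^sub>R (b - a))) has_real_derivative (b - a) \<bullet> g (a + t *\<^sub>R (b - a))) (at t)"
proof -
  have line: "((\<lambda>t. a + t *\<^sub>R (b - a)) has_derivative (\<lambda>h. h *\<^sub>R (b - a))) (at t)"
    by (auto intro!: derivative_eq_intros)
  show ?thesis
    by (rule has_derivative_imp_has_field_derivative
          [OF has_derivative_compose[OF line has_derivative_gradient[OF segment_mem[OF assms]]]]) simp
qed

text \<open>Convexity bounds the difference quotient by \<open>f b - f a\<close>. Only the limit
  from the right is taken, since the line may leave \<open>K\<close> for negative
  parameters.\<close>

lemma gradient_inequality:
  assumes "a \<in> K" "b \<in> K"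
  shows "f a + g a \<bullet> (b - a) \<le> f b"
proof -
  have "((\<lambda>t. (f (a + t *\<^sub>R (b - a)) - f a) / t) \<longlongrightarrow> (b - a) \<bullet> g a) (at_right 0)"
    using DERIV_along_segment[OF assms, of 0]
    by (auto simp: has_field_derivative_iff intro: tendsto_mono[OF at_le])
  moreover have "eventually (\<lambda>t. (f (a + t *\<^sub>R (b - a)) - f a) / t \<le> f b - f a) (at_right 0)"
    unfolding eventually_at_right_field
  proof (intro exI[of _ 1] conjI allI impI)
    fix t :: real assume t: "0 < t" "t < 1"
    have "f ((1 - t) *\<^sub>R a + t *\<^sub>R b) \<le> (1 - t) * f a + t * f b"
      using convex_onD[OF convex_f, of t a b] t assms by simp
    moreover have "(1 - t) *\<^sub>R a + t *\<^sub>R b = a + t *\<^sub>R (b - a)" by (simp add: algebra_simps)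
    ultimately show "(f (a + t *\<^sub>R (b - a)) - f a) / t \<le> f b - f a"
      using t by (simp add: field_simps)
  qed simp
  ultimately have "(b - a) \<bullet> g a \<le> f b - f a"
    by (intro tendsto_upperbound[where F = "at_right (0::real)"]) auto
  then show ?thesis by (simp add: inner_commute)
qed

text \<open>Subtracting the linear and quadratic terms from \<open>f\<close> along the segment
  leaves a function whose derivative is nonpositive, by Cauchy-Schwarz and the Lipschitz bound;
  comparing its end values gives the claim.\<close>

lemma descent:
  assumes "a \<in> K" "b \<in> K"
  shows "f b \<le> f a + g a \<bullet> (b - a) + \<beta> / 2 * (norm (b - a))\<^sup>2"
proof -
  define d where "d = b - a"
  let ?h = "\<lambda>t. f (a + t *\<^sub>R d) - t * (d \<bullet> g a) - t\<^sup>2 * (\<beta> / 2 * (norm d)\<^sup>2)"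
  have "?h 1 \<le> ?h 0"
  proof (rule DERIV_nonpos_imp_nonincreasing[where f = ?h])
    fix t :: real assume t: "0 \<le> t" "t \<le> 1"
    let ?p = "a + t *\<^sub>R d"
    have "(?h has_real_derivative d \<bullet> g ?p - d \<bullet> g a - 2 * t * (\<beta> / 2 * (norm d)\<^sup>2)) (at t)"
      using DERIV_along_segment[OF assms t] unfolding d_def[symmetric]
      by (auto intro!: derivative_eq_intros)
    moreover have "d \<bullet> g ?p - d \<bullet> g a - 2 * t * (\<beta> / 2 * (norm d)\<^sup>2) \<le> 0"
    proof -
      have "d \<bullet> (g ?p - g a) \<le> norm d * norm (g ?p - g a)" by (rule norm_cauchy_schwarz)
      also have "\<dots> \<le> norm d * (\<beta> * norm (?p - a))"
        using gradient_Lipschitz[of ?p a] segment_mem[OF assms t] assms d_def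
        by (intro mult_left_mono) auto
      also have "\<dots> = \<beta> * t * (norm d)\<^sup>2" using t by (simp add: power2_eq_square)
      finally show ?thesis by (simp add: inner_diff_right mult_ac)
    qed
    ultimately show "\<exists>y. (?h has_real_derivative y) (at t) \<and> y \<le> 0" by blast
  qed simp
  then show ?thesis by (simp add: d_def inner_commute)
qed

text \<open>
  The two auxiliary points \<open>y + w\<close> and \<open>x - w\<close> have to lie in \<open>K\<close>, so the textbook proof of
  cocoercivity (where \<open>K\<close> is the whole space) only applies locally. The resulting inequality is
  nevertheless global: it is additive along a subdivision of the segment from \<open>x\<close> to \<open>y\<close>, and
  segments in the boundary are limits of segments in the relative interior.
\<close>

lemma cocoercive_local:
  assumes "x \<in> K" "y \<in> K" "y + w \<in> K" "x - w \<in> K"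
  shows "- \<beta> * (norm w)\<^sup>2 \<le> (g y - g x) \<bullet> (2 *\<^sub>R w + (y - x))"
  \<comment> \<open>At each auxiliary point an upper bound from one end meets a tangent bound from
    the other; in the sum all values of \<open>f\<close> cancel.\<close>
  using descent[of y "y + w"] gradient_inequality[of x "y + w"]
    descent[of x "x - w"] gradient_inequality[of y "x - w"] assms
  by (simp add: algebra_simps inner_commute)

text \<open>With \<open>n\<close> pieces the local inequality needs offsets of size
  \<open>1 / (2 * n)\<close> only, so a thin tube around the segment suffices. Each piece
  contributes one \<open>n\<close>-th of the error, and the gradient differences telescope.\<close>

lemma cocoercive_chain:
  assumes "x \<in> K" "y \<in> K" "e > 0"
    and tube: "\<And>p s. p \<in> closed_segment x y \<Longrightarrow> \<bar>s\<bar> \<le> e \<Longrightarrow> p + s *\<^sub>R (b - (y - x)) \<in> K"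
  shows "- \<beta> / 4 * (norm (b - (y - x)))\<^sup>2 \<le> (g y - g x) \<bullet> b"
proof -
  define w where "w = b - (y - x)"
  obtain n :: nat where n: "n > 0" "1 / (2 * real n) \<le> e"
  proof -
    obtain n :: nat where "1 / (2 * e) \<le> real n" using real_arch_simple by blast
    then have "1 / (2 * e) \<le> real (Suc n)" by simp
    then show ?thesis using that[of "Suc n"] assms(3) by (simp add: field_simps)
  qed
  define p where "p i = x + (real i / real n) *\<^sub>R (y - x)" for i
  have seg: "p i \<in> closed_segment x y" if "i \<le> n" for i
    unfolding closed_segment_def p_def using that n(1)
    by (auto simp: algebra_simps intro!: exI[of _ "real i / real n"])
  have pK: "p i \<in> K" if "i \<le> n" for i
    using closed_segment_subset[OF assms(1,2) convex_K] seg[OF that] by blast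
  have diff: "p (Suc i) - p i = (1 / n) *\<^sub>R (y - x)" for i
    by (simp add: p_def add_divide_distrib algebra_simps)
  have step: "- \<beta> / 4 * (norm w)\<^sup>2 / n \<le> (g (p (Suc i)) - g (p i)) \<bullet> b" if "i < n" for i
  proof -
    let ?w = "(1 / (2 * real n)) *\<^sub>R w"
    have "p (Suc i) + ?w \<in> K" "p i - ?w \<in> K"
      using tube[OF seg, of "Suc i" "1 / (2 * real n)"] tube[OF seg, of i "- (1 / (2 * real n))"]
        that n(2) by (auto simp: w_def)
    then have "- \<beta> * (norm ?w)\<^sup>2 \<le> (g (p (Suc i)) - g (p i)) \<bullet> (2 *\<^sub>R ?w + (p (Suc i) - p i))"
      using that by (intro cocoercive_local pK) auto
    \<comment> \<open>The offset and the piece shrink by the same factor, so every piece is tested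
      in the same direction \<open>b\<close>.\<close>
    also have "2 *\<^sub>R ?w + (p (Suc i) - p i) = (1 / n) *\<^sub>R b"
      unfolding diff w_def by (simp add: algebra_simps)
    finally show ?thesis using n(1) by (simp add: field_simps power2_eq_square)
  qed
  have "- \<beta> / 4 * (norm w)\<^sup>2 = (\<Sum>i<n. - \<beta> / 4 * (norm w)\<^sup>2 / n)" using n(1) by simp
  also have "\<dots> \<le> (\<Sum>i<n. (g (p (Suc i)) - g (p i)) \<bullet> b)" by (intro sum_mono step) auto
  also have "\<dots> = (g (p n) - g (p 0)) \<bullet> b"
    by (simp add: inner_diff_left sum_lessThan_telescope[where f = "\<lambda>i. g (p i) \<bullet> b"])
  also have "\<dots> = (g y - g x) \<bullet> b" using n(1) by (simp add: p_def)
  finally show ?thesis unfolding w_def .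
qed

text \<open>Contracting the segment towards a relative interior point \<open>m\<close> by a ratio
  \<open>t\<close> surrounds it with a tube in \<open>K\<close> of width proportional to
  \<open>t\<close>; continuity of the gradient then allows \<open>t\<close> to tend to 0. The
  assumption on \<open>y + b\<close> keeps the offsets parallel to the affine hull.\<close>

lemma cocoercive:
  assumes "x \<in> K" "y \<in> K" "y + b \<in> affine hull K"
  shows "- \<beta> / 4 * (norm (b - (y - x)))\<^sup>2 \<le> (g y - g x) \<bullet> b"
proof -
  obtain m where "m \<in> rel_interior K"
    using rel_interior_eq_empty[OF convex_K] assms(1) by blast
  then obtain e where e: "e > 0" and ball: "ball m e \<inter> affine hull K \<subseteq> K" and m: "m \<in> K"
    by (auto simp: mem_rel_interior_ball)
  define X where "X t = x + t *\<^sub>R (m - x)" for t :: real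
  define Y where "Y t = y + t *\<^sub>R (m - y)" for t :: real
  have XY: "X t \<in> K" "Y t \<in> K" if "t \<in> {0..1}" for t
    using that segment_mem assms m unfolding X_def Y_def by auto
  let ?h = "\<lambda>t. (g (Y t) - g (X t)) \<bullet> b + \<beta> / 4 * (norm (b - (Y t - X t)))\<^sup>2"
  have cont: "continuous_on {0..1} X" "continuous_on {0..1} Y"
    unfolding X_def Y_def by (intro continuous_intros)+
  have contg: "continuous_on {0..1} (\<lambda>t. g (X t))" "continuous_on {0..1} (\<lambda>t. g (Y t))"
    by (rule continuous_on_compose2[OF continuous_gradient cont(1)], use XY in blast,
        rule continuous_on_compose2[OF continuous_gradient cont(2)], use XY in blast)
  have "0 \<le> ?h 0"
  proof (rule continuous_ge_on_closure[where f = ?h and x = 0])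
    show "continuous_on (closure {0<..<1}) ?h"
      using cont contg by (auto intro!: continuous_intros)
  next
    fix t :: real assume "t \<in> {0<..<1}"
    then have t: "0 < t" "t < 1" by auto
    let ?w = "b - (Y t - X t)"
    define N where "N = norm ?w + 1"
    have N: "N > 0" "norm ?w \<le> N" unfolding N_def by (simp_all add: add_nonneg_pos)
    \<comment> \<open>Chosen so that offsets blown up by \<open>1 / t\<close> stay within
      \<open>e / 2\<close> of \<open>m\<close>; the 1 in \<open>N\<close> avoids division by
      zero.\<close>
    define s0 where "s0 = t * e / (2 * N)"
    have s0: "s0 > 0" using t e N by (simp add: s0_def)
    have aff: "m + s *\<^sub>R ?w \<in> affine hull K" for s
    proof -
      have "m + s *\<^sub>R ((y + b) - y) \<in> affine hull K"
        by (rule mem_affine_3_minus[OF affine_affine_hull hull_inc[OF m] assms(3) hull_inc[OF assms(2)]])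
      from mem_affine_3_minus[OF affine_affine_hull this, of "X t" "Y t" s] XY[of t] t
      have "m + s *\<^sub>R ((y + b) - y) + s *\<^sub>R (X t - Y t) \<in> affine hull K"
        by (simp add: hull_inc)
      then show ?thesis by (simp add: algebra_simps)
    qed
    have "- \<beta> / 4 * (norm ?w)\<^sup>2 \<le> (g (Y t) - g (X t)) \<bullet> b"
    proof (rule cocoercive_chain[OF _ _ s0])
      fix p s assume p: "p \<in> closed_segment (X t) (Y t)" and s: "\<bar>s\<bar> \<le> s0"
      then obtain c where c: "0 \<le> c" "c \<le> 1" and "p = (1 - c) *\<^sub>R X t + c *\<^sub>R Y t"
        unfolding closed_segment_def by auto
      then have p_eq: "p = (x + c *\<^sub>R (y - x)) + t *\<^sub>R (m - (x + c *\<^sub>R (y - x)))"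
        by (simp add: X_def Y_def algebra_simps)
      have "norm ((s / t) *\<^sub>R ?w) = \<bar>s\<bar> / t * norm ?w" using t by simp
      also have "\<dots> \<le> s0 / t * N"
        using s s0 t N by (intro mult_mono divide_right_mono) auto
      also have "\<dots> = e / 2" using t N by (simp add: s0_def)
      also have "\<dots> < e" using e by simp
      finally have "m + (s / t) *\<^sub>R ?w \<in> ball m e" by (simp add: dist_norm)
      then have q: "m + (s / t) *\<^sub>R ?w \<in> K" using ball aff[of "s / t"] by blast
      \<comment> \<open>The displaced point is a convex combination of a point of the original
        segment, with weight \<open>1 - t\<close>, and of a point near \<open>m\<close>, with weight
        \<open>t\<close>.\<close>
      have "(x + c *\<^sub>R (y - x)) + t *\<^sub>R ((m + (s / t) *\<^sub>R ?w) - (x + c *\<^sub>R (y - x))) \<in> K"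
        using segment_mem[OF segment_mem[OF assms(1,2) c] q] t by simp
      moreover have "(x + c *\<^sub>R (y - x)) + t *\<^sub>R ((m + (s / t) *\<^sub>R ?w) - (x + c *\<^sub>R (y - x)))
          = p + s *\<^sub>R ?w"
        using t unfolding p_eq by (simp add: scaleR_add_right scaleR_diff_right)
      ultimately show "p + s *\<^sub>R ?w \<in> K" by simp
    qed (use XY t in auto)
    then show "0 \<le> ?h t" by simp
  qed auto
  then show ?thesis by (simp add: X_def Y_def)
qed

end

subsection \<open>The nearest extreme point oracle\<close>

text \<open>Balls are convex, so the bound passes to the hull in one argument and then in the
  other.\<close>

lemma dist_convex_hull_le:
  fixes S :: "'a::euclidean_space set"
  assumes "bounded S" "y \<in> convex hull S" "z \<in> convex hull S"
  shows "dist y z \<le> diameter S"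
proof -
  have "S \<subseteq> cball s (diameter S)" if "s \<in> S" for s
    using diameter_bounded_bound[OF assms(1) that] by auto
  then have "convex hull S \<subseteq> cball s (diameter S)" if "s \<in> S" for s
    using that by (intro hull_minimal) auto
  then have "y \<in> cball s (diameter S)" if "s \<in> S" for s
    using assms(2) that by blast
  then have "S \<subseteq> cball y (diameter S)"
    by (auto simp: dist_commute)
  then have "convex hull S \<subseteq> cball y (diameter S)"
    by (intro hull_minimal) auto
  then show ?thesis using assms(3) by auto
qed

text \<open>Averaging \<open>opt\<close> over a representation of \<open>z\<close> reproduces the
  linear part exactly, while the quadratic part exceeds its value at \<open>z\<close> by
  \<open>k\<close> times the variance.\<close>

lemma regularized_oracle_bound:
  fixes z :: "'a::euclidean_space"
  assumes "z \<in> convex hull S" "bounded S" "k \<ge> 0"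
    and opt: "\<And>u. u \<in> S \<Longrightarrow> c \<le> u \<bullet> G + k * (norm (p - u))\<^sup>2"
  shows "c \<le> z \<bullet> G + k * ((norm (p - z))\<^sup>2 + (diameter S)\<^sup>2 / 2)"
proof -
  obtain T u where T: "finite T" "T \<subseteq> S" "\<forall>s\<in>T. 0 \<le> u s" "sum u T = 1"
    "(\<Sum>s\<in>T. u s *\<^sub>R s) = z" and V: "(\<Sum>s\<in>T. u s * (norm (s - z))\<^sup>2) \<le> (diameter S)\<^sup>2 / 2"
    using convex_hull_small_variance[OF assms(1,2)] by blast
  have "c = (\<Sum>s\<in>T. u s * c)" using T(4) by (simp flip: sum_distrib_right)
  also have "\<dots> \<le> (\<Sum>s\<in>T. u s * (s \<bullet> G + k * (norm (s - p))\<^sup>2))"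
    using opt T(2,3) by (intro sum_mono mult_left_mono) (auto simp: norm_minus_commute)
  also have "\<dots> = (\<Sum>s\<in>T. u s *\<^sub>R s) \<bullet> G + k * (\<Sum>s\<in>T. u s * (norm (s - p))\<^sup>2)"
    by (simp add: inner_sum_left sum_distrib_left sum.distrib algebra_simps)
  also have "\<dots> = z \<bullet> G + k * ((\<Sum>s\<in>T. u s * (norm (s - z))\<^sup>2) + (norm (p - z))\<^sup>2)"
    unfolding weighted_sum_sq_dist[OF T(4,5), of p] T(5) by (simp add: norm_minus_commute)
  also have "\<dots> \<le> z \<bullet> G + k * ((diameter S)\<^sup>2 / 2 + (norm (p - z))\<^sup>2)"
    using V assms(3) by (intro add_left_mono mult_left_mono add_right_mono)
  finally show ?thesis by (simp add: add.commute)
qed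

section \<open>Minimizers, iterates and single-step bounds for a run of the algorithm\<close>

locale nep_run = smooth_convex K f \<beta>
  for K :: "'a::euclidean_space set" and f \<beta> +
  fixes S :: "'a set" and x :: "nat \<Rightarrow> 'a"
  assumes compact_K: "compact K" and support: "min_diameter_support K f S"
    and run: "nep_frank_wolfe K f \<beta> (\<lambda>t. 2 / (real t + 1)) x"
begin

abbreviation "X \<equiv> argmin_set K f"
abbreviation "D \<equiv> diameter S"
abbreviation "h t \<equiv> f (x t) - min_value K f"
abbreviation "d t \<equiv> infdist (x t) X"

lemma extreme_subset: "extreme_points K \<subseteq> K"
  unfolding extreme_points_def extreme_point_of_def by blast

lemma x1: "x 1 \<in> K"
  using run extreme_subset unfolding nep_frank_wolfe_def by blast

lemma bounded_S: "bounded S"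
  using support extreme_subset compact_imp_bounded[OF compact_K]
  unfolding min_diameter_support_def is_arg_min_def by (metis bounded_subset)

lemma mem_X_iff: "z \<in> X \<longleftrightarrow> z \<in> K \<and> (\<forall>y\<in>K. f z \<le> f y)"
  unfolding argmin_set_def is_arg_min_linorder by blast

lemma X_value: "z \<in> X \<Longrightarrow> f z = min_value K f"
  unfolding mem_X_iff min_value_def
  by (intro cInf_eq_minimum[symmetric]) auto

lemma X_nonempty: "X \<noteq> {}"
  using continuous_attains_inf[OF compact_K _ continuous_f] x1 mem_X_iff by blast

lemma closed_X: "closed X"
proof -
  obtain z where z: "z \<in> X" using X_nonempty by blast
  then have "X = {y \<in> K. f y \<in> {..f z}}" using mem_X_iff by force
  moreover have "closed {y \<in> K. f y \<in> {..f z}}"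
    using continuous_closed_preimage[OF continuous_f compact_imp_closed[OF compact_K], of "{..f z}"]
    by (simp add: vimage_def Int_def)
  ultimately show ?thesis by simp
qed

lemma min_value_le: "y \<in> K \<Longrightarrow> min_value K f \<le> f y"
proof -
  assume "y \<in> K"
  moreover obtain z where "z \<in> X" using X_nonempty by blast
  ultimately show ?thesis using X_value[of z] mem_X_iff[of z] by auto
qed

lemma nearest:
  obtains z where "z \<in> X" "infdist y X = norm (y - z)"
  using infdist_attains_inf[OF closed_X X_nonempty] by (metis dist_norm)

lemma oracle_bound:
  assumes "z \<in> X" "k \<ge> 0"
    and "is_arg_min (\<lambda>u. u \<bullet> G + k * (norm (p - u))\<^sup>2) (\<lambda>u. u \<in> extreme_points K) v"
  shows "v \<bullet> G + k * (norm (p - v))\<^sup>2 \<le> z \<bullet> G + k * ((norm (p - z))\<^sup>2 + D\<^sup>2 / 2)"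
proof (rule regularized_oracle_bound[OF _ bounded_S assms(2)])
  show "z \<in> convex hull S"
    using support assms(1) unfolding min_diameter_support_def is_arg_min_def by blast
  fix u assume "u \<in> S"
  then have "u \<in> extreme_points K"
    using support unfolding min_diameter_support_def is_arg_min_def by blast
  then show "v \<bullet> G + k * (norm (p - v))\<^sup>2 \<le> u \<bullet> G + k * (norm (p - u))\<^sup>2"
    using assms(3) unfolding is_arg_min_linorder by blast
qed

lemma run_step:
  assumes "t \<ge> 1"
  obtains v \<gamma> where
    "is_arg_min (\<lambda>u. u \<bullet> g (x t) + \<beta> * (2 / (real t + 1)) / 2 * (norm (x t - u))\<^sup>2)
       (\<lambda>u. u \<in> extreme_points K) v" "v \<in> K"
    "0 \<le> \<gamma>" "\<gamma> \<le> 1" "x (Suc t) = x t + \<gamma> *\<^sub>R (v - x t)"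
    "f (x (Suc t)) \<le> f (x t + (2 / (real t + 1)) *\<^sub>R (v - x t))" "f (x (Suc t)) \<le> f (x t)"
proof -
  have eq: "(1 - c) *\<^sub>R p + c *\<^sub>R q = p + c *\<^sub>R (q - p)" for c and p q :: 'a
    by (simp add: algebra_simps)
  obtain v \<gamma> where v: "is_arg_min (\<lambda>u. u \<bullet> g (x t) + \<beta> * (2 / (real t + 1)) / 2 * (norm (x t - u))\<^sup>2)
       (\<lambda>u. u \<in> extreme_points K) v"
    and \<gamma>: "\<gamma> \<in> {0..1}" "x (Suc t) = x t + \<gamma> *\<^sub>R (v - x t)"
    "f (x t + \<gamma> *\<^sub>R (v - x t)) \<le> min (f (x t + (2 / (real t + 1)) *\<^sub>R (v - x t))) (f (x t))"
    using run assms unfolding nep_frank_wolfe_def eq by blast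
  have "v \<in> K" using v extreme_subset unfolding is_arg_min_def by blast
  show ?thesis by (rule that[OF v \<open>v \<in> K\<close>]) (use \<gamma> in auto)
qed

lemma x_mem: "t \<ge> 1 \<Longrightarrow> x t \<in> K"
proof (induction t rule: nat_induct_at_least)
  case base
  then show ?case by (rule x1)
next
  case (Suc t)
  then show ?case using run_step[of t] segment_mem by metis
qed

lemma f_le_initial: "t \<ge> 1 \<Longrightarrow> f (x t) \<le> f (x 1)"
proof (induction t rule: nat_induct_at_least)
  case (Suc t)
  then show ?case using run_step[of t] order_trans by metis
qed simp

lemma h_nonneg: "t \<ge> 1 \<Longrightarrow> 0 \<le> h t"
  using min_value_le[OF x_mem] by simp

text \<open>As \<open>f\<close> never increases along the run, an iterate and its nearest minimizer
  both lie in the initial level set.\<close>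

lemma d_le_level_diameter:
  assumes "t \<ge> 1"
  shows "d t \<le> level_diameter K f (x 1)"
proof -
  obtain z where z: "z \<in> X" "d t = norm (x t - z)" using nearest by blast
  have "dist (x t) z \<le> diameter {u \<in> K. f u \<le> f (x 1)}"
  proof (rule diameter_bounded_bound)
    show "bounded {u \<in> K. f u \<le> f (x 1)}"
      using compact_imp_bounded[OF compact_K] by (rule bounded_subset) blast
  qed (use x_mem[OF assms] f_le_initial[OF assms] z(1) x1 mem_X_iff in auto)
  then show ?thesis using z(2) by (simp add: level_diameter_def dist_norm)
qed

lemma progress:
  assumes "t \<ge> 1"
  shows "h (Suc t) \<le> (1 - 2 / (real t + 1)) * h t
           + \<beta> * (2 / (real t + 1))\<^sup>2 / 2 * (D\<^sup>2 / 2 + (d t)\<^sup>2)"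
proof -
  define \<eta> where "\<eta> = 2 / (real t + 1)"
  have \<eta>: "0 \<le> \<eta>" "\<eta> \<le> 1" using assms by (auto simp: \<eta>_def)
  obtain v where v: "is_arg_min (\<lambda>u. u \<bullet> g (x t) + \<beta> * \<eta> / 2 * (norm (x t - u))\<^sup>2)
       (\<lambda>u. u \<in> extreme_points K) v" "v \<in> K"
    and dec: "f (x (Suc t)) \<le> f (x t + \<eta> *\<^sub>R (v - x t))"
    using run_step[OF assms, folded \<eta>_def] by blast
  obtain z where z: "z \<in> X" "d t = norm (x t - z)" using nearest by blast
  have "z \<in> K" using z(1) mem_X_iff by blast
  let ?G = "g (x t)"
  note xK = x_mem[OF assms]
  have "f (x t + \<eta> *\<^sub>R (v - x t))
      \<le> f (x t) + \<eta> * (?G \<bullet> (v - x t)) + \<beta> / 2 * (\<eta>\<^sup>2 * (norm (x t - v))\<^sup>2)"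
    using descent[OF xK segment_mem[OF xK v(2) \<eta>]] \<eta>
    by (simp add: power_mult_distrib norm_minus_commute)
  \<comment> \<open>With one factor \<open>\<eta>\<close> pulled out, the descent bound contains
    exactly the objective that the oracle minimizes.\<close>
  also have "\<dots> = f (x t) + \<eta> * (v \<bullet> ?G + \<beta> * \<eta> / 2 * (norm (x t - v))\<^sup>2 - x t \<bullet> ?G)"
    by (simp add: algebra_simps power2_eq_square inner_commute)
  also have "\<dots> \<le> f (x t) + \<eta> * (z \<bullet> ?G + \<beta> * \<eta> / 2 * ((norm (x t - z))\<^sup>2 + D\<^sup>2 / 2) - x t \<bullet> ?G)"
    using oracle_bound[OF z(1) _ v(1)] \<eta> beta_pos by (intro add_left_mono mult_left_mono) auto
  also have "\<dots> = f (x t) + \<eta> * (?G \<bullet> (z - x t)) + \<beta> * \<eta>\<^sup>2 / 2 * (D\<^sup>2 / 2 + (d t)\<^sup>2)"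
    unfolding z(2) by (simp add: algebra_simps power2_eq_square inner_commute)
  also have "\<dots> \<le> f (x t) + \<eta> * (min_value K f - f (x t)) + \<beta> * \<eta>\<^sup>2 / 2 * (D\<^sup>2 / 2 + (d t)\<^sup>2)"
  proof (intro add_right_mono add_left_mono mult_left_mono)
    show "?G \<bullet> (z - x t) \<le> min_value K f - f (x t)"
      using gradient_inequality[OF xK \<open>z \<in> K\<close>] X_value[OF z(1)] by simp
  qed (use \<eta> in simp)
  finally show ?thesis using dec unfolding \<eta>_def[symmetric] by (simp add: algebra_simps)
qed

text \<open>
  Of the two bounds \<open>H1\<close> and \<open>H2\<close> below, the second one is better when \<open>M\<close> is positive; this
  compensates for \<open>x 1\<close> being farther from \<open>y\<close> than from its nearest minimizer \<open>z\<close>. The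
  direction \<open>W - a\<close> in the cocoercivity inequality makes the remaining slack a perfect square.
\<close>

lemma first_step_growth:
  assumes growth: "quadratic_growth K \<alpha> f"
  shows "h 2 \<le> \<beta> * D\<^sup>2 / 2 + 2 * \<beta>\<^sup>2 / \<alpha> * (D\<^sup>2 + (d 1)\<^sup>2)"
proof -
  have \<alpha>: "\<alpha> > 0" using growth unfolding quadratic_growth_def by simp
  define \<theta> where "\<theta> = 2 * \<beta> / \<alpha>"
  have \<theta>: "\<theta> > 0" using \<alpha> beta_pos by (simp add: \<theta>_def)
  have goal_eq: "2 * \<beta>\<^sup>2 / \<alpha> = \<theta> * \<beta>" by (simp add: \<theta>_def power2_eq_square)
  show ?thesis
  \<comment> \<open>For poor conditioning the general progress bound is already strong
    enough.\<close>
  proof (cases "\<theta> \<ge> 1")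
    case True
    have "h 2 \<le> \<beta> / 2 * (D\<^sup>2 / 2 + (d 1)\<^sup>2)"
      using progress[of 1] by (simp add: numeral_2_eq_2)
    also have "\<dots> \<le> 1 * \<beta> * (D\<^sup>2 + (d 1)\<^sup>2)" using beta_pos by (simp add: field_simps)
    also have "\<dots> \<le> \<theta> * \<beta> * (D\<^sup>2 + (d 1)\<^sup>2)"
      using True beta_pos by (intro mult_right_mono) auto
    also have "\<dots> \<le> \<beta> * D\<^sup>2 / 2 + \<theta> * \<beta> * (D\<^sup>2 + (d 1)\<^sup>2)" using beta_pos by simp
    finally show ?thesis unfolding goal_eq .
  next
    case False
    \<comment> \<open>The first prescribed step is full, so the comparison point is the oracle
      answer itself.\<close>
    have unit_step: "2 / (real 1 + 1) = 1" by simp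
    obtain v where v: "is_arg_min (\<lambda>u. u \<bullet> g (x 1) + \<beta> * 1 / 2 * (norm (x 1 - u))\<^sup>2)
        (\<lambda>u. u \<in> extreme_points K) v" "v \<in> K"
      and "f (x (Suc 1)) \<le> f (x 1 + 1 *\<^sub>R (v - x 1))"
      using run_step[OF order_refl, unfolded unit_step] by blast
    then have dec: "f (x 2) \<le> f v" by (simp add: numeral_2_eq_2)
    obtain z where z: "z \<in> X" "d 1 = norm (x 1 - z)" using nearest by blast
    obtain y where y: "y \<in> X" "infdist v X = norm (v - y)" using nearest by blast
    have K: "z \<in> K" "y \<in> K" using z y mem_X_iff by auto
    \<comment> \<open>Differences are taken relative to \<open>y\<close>, the minimizer nearest to
      the oracle answer, because growth at \<open>v\<close> controls the norm of
      \<open>w\<close>.\<close>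
    define w a \<delta> \<Delta> where "w = v - y" and "a = z - y" and "\<delta> = x 1 - y"
      and "\<Delta> = g (x 1) - g y"
    define H where "H = f v - min_value K f"
    define M where "M = \<beta> / 2 * ((norm \<delta>)\<^sup>2 - (d 1)\<^sup>2) - \<Delta> \<bullet> a"
    have wH: "\<beta> * (norm w)\<^sup>2 \<le> \<theta> * H"
    proof -
      have "(norm w)\<^sup>2 \<le> 2 / \<alpha> * H"
        using growth v(2) y(2) unfolding quadratic_growth_def H_def w_def by metis
      then have "\<beta> * (norm w)\<^sup>2 \<le> \<beta> * (2 / \<alpha> * H)"
        using beta_pos by (intro mult_left_mono) auto
      then show ?thesis by (simp add: \<theta>_def mult_ac)
    qed
    have aD: "(norm a)\<^sup>2 \<le> D\<^sup>2"
    proof -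
      have "X \<subseteq> convex hull S"
        using support unfolding min_diameter_support_def is_arg_min_def by blast
      then have "dist z y \<le> D"
        using z(1) y(1) by (intro dist_convex_hull_le bounded_S) auto
      then show ?thesis by (intro power_mono) (auto simp: a_def dist_norm)
    qed
    have smooth_v: "H \<le> g y \<bullet> w + \<beta> / 2 * (norm w)\<^sup>2"
      using descent[OF K(2) v(2)] X_value[OF y(1)] by (simp add: H_def w_def)
    have ga: "g y \<bullet> a \<le> 0"
      using gradient_inequality[OF K(2,1)] X_value z(1) y(1) by (simp add: a_def)
    have xv: "x 1 - v = \<delta> - w" by (simp add: \<delta>_def w_def)
    have expand: "(norm (\<delta> - w))\<^sup>2 = (norm \<delta>)\<^sup>2 - 2 * (\<delta> \<bullet> w) + (norm w)\<^sup>2"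
      unfolding power2_norm_eq_inner by (simp add: algebra_simps inner_commute)
    have "g (x 1) \<bullet> w + \<beta> / 2 * (norm (\<delta> - w))\<^sup>2 \<le> \<beta> / 2 * ((norm \<delta>)\<^sup>2 + D\<^sup>2 / 2)"
      using oracle_bound[OF y(1) _ v(1)] beta_pos
      unfolding xv[symmetric] unfolding w_def \<delta>_def
      by (simp add: inner_diff_left inner_diff_right inner_commute algebra_simps)
    then have H1: "H \<le> \<beta> * (\<delta> \<bullet> w) - \<Delta> \<bullet> w + \<beta> * D\<^sup>2 / 4"
      using smooth_v unfolding expand \<Delta>_def by (simp add: algebra_simps)
    have "g (x 1) \<bullet> w - g (x 1) \<bullet> a + \<beta> / 2 * (norm (\<delta> - w))\<^sup>2 \<le> \<beta> / 2 * ((d 1)\<^sup>2 + D\<^sup>2 / 2)"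
      using oracle_bound[OF z(1) _ v(1)] beta_pos
      unfolding xv[symmetric] z(2) unfolding w_def a_def
      by (simp add: inner_diff_left inner_diff_right inner_commute algebra_simps)
    then have H2: "H \<le> \<beta> * (\<delta> \<bullet> w) - \<Delta> \<bullet> w + \<beta> * D\<^sup>2 / 4 - M"
      using smooth_v ga unfolding expand \<Delta>_def M_def by (simp add: algebra_simps)
    \<comment> \<open>This scaling turns the quadratic term into
      \<open>\<beta> * (norm w)\<^sup>2 / (2 * \<theta>)\<close>, which growth bounds by
      \<open>H / 2\<close> and which the left side can absorb.\<close>
    define W where "W = (1 / \<theta>) *\<^sub>R w"
    have w_eq: "w = \<theta> *\<^sub>R W" using \<theta> by (simp add: W_def)
    have "\<beta> * (\<delta> \<bullet> W) - \<Delta> \<bullet> W \<le> \<beta> / 2 * (norm W)\<^sup>2 + \<beta> / 2 * ((norm a)\<^sup>2 + (norm \<delta>)\<^sup>2) - \<Delta> \<bullet> a"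
    proof -
      \<comment> \<open>Since \<open>1 / \<theta> > 1\<close> here, this point may leave
        \<open>K\<close>, but not its affine hull.\<close>
      have "x 1 + (1 / \<theta>) *\<^sub>R (v - y) + (- 1) *\<^sub>R (z - y) \<in> affine hull K"
        using K v(2) x1 by (intro mem_affine_3_minus affine_affine_hull hull_inc)
      then have "x 1 + (W - a) \<in> affine hull K" by (simp add: W_def w_def a_def algebra_simps)
      from cocoercive[OF K(2) x1 this]
      have "- \<beta> / 4 * (norm (W - a - \<delta>))\<^sup>2 \<le> \<Delta> \<bullet> (W - a)"
        by (simp add: \<Delta>_def \<delta>_def)
      moreover have "\<beta> / 2 * (norm W)\<^sup>2 + \<beta> / 2 * ((norm a)\<^sup>2 + (norm \<delta>)\<^sup>2) - \<beta> * (\<delta> \<bullet> W)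
          - \<beta> / 4 * (norm (W - a - \<delta>))\<^sup>2 = \<beta> / 4 * (norm (W + a - \<delta>))\<^sup>2"
        unfolding power2_norm_eq_inner by (simp add: algebra_simps inner_commute)
      moreover have "0 \<le> \<beta> / 4 * (norm (W + a - \<delta>))\<^sup>2" using beta_pos by simp
      ultimately show ?thesis by (simp add: inner_diff_right)
    qed
    from mult_left_mono[OF this, of \<theta>] \<theta>
    have "\<beta> * (\<delta> \<bullet> w) - \<Delta> \<bullet> w
        \<le> \<beta> / 2 * (norm w)\<^sup>2 / \<theta> + \<theta> * (\<beta> / 2 * ((norm a)\<^sup>2 + (norm \<delta>)\<^sup>2) - \<Delta> \<bullet> a)"
      unfolding w_eq by (simp add: algebra_simps power2_eq_square)
    also have "\<dots> = \<beta> * (norm w)\<^sup>2 / (2 * \<theta>) + \<theta> * (\<beta> / 2 * ((norm a)\<^sup>2 + (d 1)\<^sup>2) + M)"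
      by (simp add: M_def algebra_simps)
    also have "\<dots> \<le> H / 2 + \<theta> * (\<beta> / 2 * (D\<^sup>2 + (d 1)\<^sup>2) + M)"
    proof (intro add_mono mult_left_mono)
      show "\<beta> * (norm w)\<^sup>2 / (2 * \<theta>) \<le> H / 2" using wH \<theta> by (simp add: field_simps)
    qed (use aD beta_pos \<theta> in auto)
    finally have key: "\<beta> * (\<delta> \<bullet> w) - \<Delta> \<bullet> w \<le> H / 2 + \<theta> * \<beta> / 2 * (D\<^sup>2 + (d 1)\<^sup>2) + \<theta> * M"
      by (simp add: algebra_simps)
    \<comment> \<open>The better of \<open>H1\<close> and \<open>H2\<close> subtracts
      \<open>max 0 M\<close>, which cancels \<open>\<theta> * M\<close> from \<open>key\<close>
      because \<open>\<theta> < 1\<close>; doubling what remains gives the claim.\<close>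
    have "\<theta> * M \<le> max 0 M"
    proof (cases "M \<ge> 0")
      case True
      then show ?thesis using mult_right_mono[of \<theta> 1 M] False by simp
    next
      case False
      then show ?thesis using \<theta> by (simp add: mult_nonneg_nonpos)
    qed
    then have "H \<le> \<beta> * D\<^sup>2 / 2 + \<theta> * \<beta> * (D\<^sup>2 + (d 1)\<^sup>2)"
      using H1 H2 key by (auto simp: max_def split: if_splits)
    then show ?thesis using dec unfolding goal_eq H_def by simp
  qed
qed

end

subsection \<open>Solving the recursions\<close>

text \<open>The factor of \<open>h 1\<close> vanishes, so no initial bound is required. The
  induction comes down to \<open>t * (t + 2) \<le> (t + 1)\<^sup>2\<close>.\<close>

lemma frank_wolfe_rate:
  fixes h :: "nat \<Rightarrow> real"
  assumes "\<beta> \<ge> 0" "C \<ge> 0"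
    and step: "\<And>t. t \<ge> 1 \<Longrightarrow>
      h (Suc t) \<le> (1 - 2 / (real t + 1)) * h t + \<beta> * (2 / (real t + 1))\<^sup>2 / 2 * C"
    and "t \<ge> 2"
  shows "h t \<le> 2 * \<beta> * C / (real t + 1)"
  using \<open>t \<ge> 2\<close>
proof (induction t rule: nat_induct_at_least)
  case base
  have "h 2 \<le> \<beta> * C / 2" using step[of 1] by (simp add: numeral_2_eq_2)
  also have "\<dots> \<le> 2 * \<beta> * C / (real 2 + 1)" using assms(1,2) by simp
  finally show ?case .
next
  case (Suc t)
  define B where "B = \<beta> * C"
  have B: "B \<ge> 0" using assms(1,2) by (simp add: B_def)
  have "h (Suc t) \<le> (1 - 2 / (real t + 1)) * (2 * B / (real t + 1)) + (2 / (real t + 1))\<^sup>2 / 2 * B"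
    using step[of t] Suc mult_left_mono[OF Suc.IH, of "1 - 2 / (real t + 1)"]
    by (simp add: B_def mult_ac)
  also have "\<dots> = 2 * B * (real t / (real t + 1)\<^sup>2)"
  proof -
    have "(1 - 2 / N) * (2 * B / N) + (2 / N)\<^sup>2 / 2 * B = 2 * B * ((N - 1) / N\<^sup>2)"
      if "N \<noteq> 0" for N
      using that by (simp add: field_simps power2_eq_square)
    from this[of "real t + 1"] show ?thesis by simp
  qed
  also have "\<dots> \<le> 2 * B * (1 / (real (Suc t) + 1))"
  proof (rule mult_left_mono)
    have "(real t + 1)\<^sup>2 > 0" "real t * (real t + 2) \<le> (real t + 1)\<^sup>2"
      by (simp, simp add: power2_eq_square algebra_simps)
    then show "real t / (real t + 1)\<^sup>2 \<le> 1 / (real (Suc t) + 1)" by (simp add: field_simps)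
  qed (use B in simp)
  finally show ?case by (simp add: B_def)
qed

text \<open>The constant is what the base case \<open>t = 3\<close> of the next lemma demands:
  \<open>1 + 4 / 9 \<le> 4 / 3 * ln 3\<close>. It comes from 2.72 exceeding the base of
  \<open>ln\<close>.\<close>

lemma ln_3_ge: "ln 3 \<ge> (13 / 12 :: real)"
proof -
  have "13 * 1 \<le> 13 * ln (272 / 100 :: real)" using ln_272_gt_1 by linarith
  also have "\<dots> = ln ((272 / 100) ^ 13)" by (subst ln_realpow) auto
  also have "\<dots> \<le> ln (3 ^ 12)" by (subst ln_le_cancel_iff) (auto simp: power_divide)
  also have "\<dots> = 12 * ln 3" by (subst ln_realpow) auto
  finally show ?thesis by simp
qed

text \<open>Here \<open>E\<close> stands for half the squared diameter of the support and
  \<open>d\<close> for the squared distance to the minimizers. The crude rate makes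
  \<open>d t\<close> of order \<open>1 / t\<close>, so after weighting by \<open>t * (t + 1)\<close>
  its contributions sum like a harmonic series.\<close>

lemma frank_wolfe_growth_rate:
  fixes h d :: "nat \<Rightarrow> real"
  assumes "\<beta> > 0" "\<alpha> > 0" "E \<ge> 0" "A \<ge> 0"
    and step: "\<And>t. t \<ge> 1 \<Longrightarrow>
      h (Suc t) \<le> (1 - 2 / (real t + 1)) * h t + \<beta> * (2 / (real t + 1))\<^sup>2 / 2 * (E + d t)"
    and d_le: "\<And>t. t \<ge> 1 \<Longrightarrow> d t \<le> A" and growth: "\<And>t. t \<ge> 1 \<Longrightarrow> d t \<le> 2 / \<alpha> * h t"
    and h2: "h 2 \<le> \<beta> * E + 2 * \<beta>\<^sup>2 / \<alpha> * (2 * E + A)"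
    and "t \<ge> 3"
  shows "h t \<le> 2 * \<beta> * (2 * E) / (real t + 1) + 8 * \<beta>\<^sup>2 / \<alpha> * (2 * E + A) * ln t / (real t)\<^sup>2"
proof -
  define Q where "Q = 4 * \<beta>\<^sup>2 / \<alpha> * (2 * E + A)"
  have Q: "Q \<ge> 0" using assms(2-4) by (simp add: Q_def)
  have d: "2 * \<beta> * d t \<le> 2 * Q / (real t + 1)" if "t \<ge> 2" for t
  proof -
    have "h t \<le> 2 * \<beta> * (E + A) / (real t + 1)"
    proof (rule frank_wolfe_rate[OF _ _ _ that])
      fix s :: nat assume s: "s \<ge> 1"
      have "\<beta> * (2 / (real s + 1))\<^sup>2 / 2 * (E + d s) \<le> \<beta> * (2 / (real s + 1))\<^sup>2 / 2 * (E + A)"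
        using d_le[OF s] assms(1) by (intro mult_left_mono) auto
      then show "h (Suc s) \<le> (1 - 2 / (real s + 1)) * h s + \<beta> * (2 / (real s + 1))\<^sup>2 / 2 * (E + A)"
        using step[OF s] by linarith
    qed (use assms in auto)
    \<comment> \<open>Weakened so that the same constant \<open>Q\<close> serves here and in
      \<open>h2\<close>.\<close>
    also have "\<dots> \<le> 2 * \<beta> * (2 * E + A) / (real t + 1)"
      using assms(1,3) by (intro divide_right_mono mult_left_mono) auto
    finally have "2 / \<alpha> * h t \<le> 2 / \<alpha> * (2 * \<beta> * (2 * E + A) / (real t + 1))"
      using assms(2) by (intro mult_left_mono) auto
    then have "2 * \<beta> * d t \<le> 2 * \<beta> * (2 / \<alpha> * (2 * \<beta> * (2 * E + A) / (real t + 1)))"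
      using growth[of t] that assms(1) by (intro mult_left_mono) auto
    also have "\<dots> = 2 * Q / (real t + 1)" by (simp add: Q_def power2_eq_square)
    finally show ?thesis .
  qed
  have rec: "(real t + 1) * real t * h (Suc t) \<le> real t * (real t - 1) * h t + 2 * \<beta> * E + 2 * Q * real t / (real t + 1)\<^sup>2"
    if "t \<ge> 2" for t
  proof -
    have "(real t + 1) * real t * h (Suc t) \<le> (real t + 1) * real t *
        ((1 - 2 / (real t + 1)) * h t + \<beta> * (2 / (real t + 1))\<^sup>2 / 2 * (E + d t))"
      using step[of t] that by (intro mult_left_mono) auto
    also have "\<dots> = real t * (real t - 1) * h t + real t / (real t + 1) * (2 * \<beta> * E) + real t / (real t + 1) * (2 * \<beta> * d t)"
    proof -
      have "N * (N - 1) * ((1 - 2 / N) * H + \<beta> * (2 / N)\<^sup>2 / 2 * (E + \<delta>))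
          = (N - 1) * (N - 2) * H + (N - 1) / N * (2 * \<beta> * E) + (N - 1) / N * (2 * \<beta> * \<delta>)"
        if "N \<noteq> 0" for N H \<delta>
        using that by (simp add: field_simps power2_eq_square)
      from this[of "real t + 1" "h t" "d t"] show ?thesis by simp
    qed
    also have "\<dots> \<le> real t * (real t - 1) * h t + 1 * (2 * \<beta> * E) + real t / (real t + 1) * (2 * Q / (real t + 1))"
      using d[OF that] assms(1,3) by (intro add_mono mult_right_mono mult_left_mono order_refl) auto
    finally show ?thesis by (simp add: power2_eq_square mult_ac)
  qed
  \<comment> \<open>The factor \<open>(t - 1) / t\<close> on the logarithm leaves exactly
    \<open>ln t / t\<^sup>2\<close> after division by \<open>t * (t - 1)\<close>. The induction
    starts at 3: at 2 it would ask for \<open>Q * ln 2\<close>, where \<open>h2\<close> gives only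
    \<open>Q\<close>.\<close>
  have main: "real t * (real t - 1) * h t \<le> 2 * \<beta> * E * (real t - 1) + 2 * Q * ln t * (real t - 1) / real t"
    using \<open>t \<ge> 3\<close>
  proof (induction t rule: nat_induct_at_least)
    case base
    have "6 * h 3 \<le> 4 * \<beta> * E + (1 + 4 / 9) * Q"
    proof -
      have "h 2 \<le> \<beta> * E + Q / 2" using h2 by (simp add: Q_def)
      moreover have "6 * h 3 \<le> 2 * h 2 + 2 * \<beta> * E + 4 / 9 * Q"
        using rec[of 2] by (simp add: eval_nat_numeral)
      ultimately show ?thesis by (simp add: algebra_simps)
    qed
    also have "\<dots> \<le> 4 * \<beta> * E + 4 / 3 * ln 3 * Q"
      using Q ln_3_ge by (intro add_left_mono mult_right_mono) auto
    finally show ?case by (simp add: mult_ac)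
  next
    case (Suc t)
    have t: "real t \<ge> 3" using Suc by simp
    have ln_step: "ln (real t) + 1 / (real t + 1) \<le> ln (real t + 1)"
    proof -
      have "ln (real t / (real t + 1)) \<le> real t / (real t + 1) - 1"
        using t by (intro ln_le_minus_one) auto
      also have "\<dots> = - (1 / (real t + 1))" using t by (simp add: field_simps)
      finally show ?thesis using t by (simp add: ln_div)
    qed
    have "ln (real t) * (real t - 1) / real t + real t / (real t + 1)\<^sup>2
        \<le> ln (real t) * (real t / (real t + 1)) + real t / (real t + 1)\<^sup>2"
    proof (intro add_right_mono)
      have "ln (real t) * ((real t - 1) / real t) \<le> ln (real t) * (real t / (real t + 1))"
        using t by (intro mult_left_mono) (auto simp: field_simps)
      then show "ln (real t) * (real t - 1) / real t \<le> ln (real t) * (real t / (real t + 1))" by simp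
    qed
    also have "\<dots> = (ln (real t) + 1 / (real t + 1)) * (real t / (real t + 1))"
      unfolding power2_eq_square distrib_right[of "ln (real t)"] by simp
    also have "\<dots> \<le> ln (real t + 1) * (real t / (real t + 1))"
      using ln_step t by (intro mult_right_mono) auto
    finally have "2 * Q * (ln (real t) * (real t - 1) / real t + real t / (real t + 1)\<^sup>2)
        \<le> 2 * Q * (ln (real t + 1) * (real t / (real t + 1)))"
      using Q by (intro mult_left_mono) auto
    then have "(real t + 1) * real t * h (Suc t)
        \<le> 2 * \<beta> * E * real t + 2 * Q * (ln (real t + 1) * (real t / (real t + 1)))"
      using rec[of t] Suc by (simp add: algebra_simps)
    then show ?case by (simp add: add.commute mult_ac)
  qed
  have t: "real t \<ge> 3" using \<open>t \<ge> 3\<close> by simp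
  have "h t = real t * (real t - 1) * h t / (real t * (real t - 1))" using t by simp
  also have "\<dots> \<le> (2 * \<beta> * E * (real t - 1) + 2 * Q * ln t * (real t - 1) / real t) / (real t * (real t - 1))"
    using main t by (intro divide_right_mono) auto
  also have "\<dots> = 2 * \<beta> * E * (1 / real t) + 2 * Q * ln t / (real t)\<^sup>2"
    using t by (simp add: field_simps power2_eq_square)
  \<comment> \<open>Passing from \<open>1 / t\<close> to \<open>2 / (t + 1)\<close> uses up the
    factor two between \<open>E\<close> and the full squared diameter.\<close>
  also have "\<dots> \<le> 2 * \<beta> * E * (2 / (real t + 1)) + 2 * Q * ln t / (real t)\<^sup>2"
    using t assms(1,3) by (intro add_right_mono mult_left_mono) (auto simp: field_simps)
  finally show ?thesis by (simp add: Q_def)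
qed

section \<open>Both rates for the algorithm\<close>

theorem theorem1:
  fixes K :: "(real ^ 'n) set" and f :: "real ^ 'n \<Rightarrow> real" and \<beta> :: real
    and S :: "(real ^ 'n) set" and x :: "nat \<Rightarrow> real ^ 'n"
  assumes "convex K" and "compact K"
    and "convex_on K f" and "smooth_over K \<beta> f"
    and "min_diameter_support K f S"
    and "nep_frank_wolfe K f \<beta> (\<lambda>t. 2 / (real t + 1)) x"
  shows
    "(\<forall>t\<ge>2. f (x t) - min_value K f
        \<le> 2 * \<beta> * ((diameter S)\<^sup>2 + (level_diameter K f (x 1))\<^sup>2) / (real t + 1)) \<and>
     (\<forall>\<alpha>. quadratic_growth K \<alpha> f \<longrightarrow>
       (\<forall>t\<ge>2. f (x t) - min_value K f
          \<le> 2 * \<beta> * (diameter S)\<^sup>2 / (real t + 1)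
            + 8 * \<beta>\<^sup>2 / \<alpha>
                * ((diameter S)\<^sup>2
                   + min (2 / \<alpha> * (f (x 1) - min_value K f)) ((level_diameter K f (x 1))\<^sup>2))
                * log 2 (real t) / (real t)\<^sup>2) \<and>
       (\<forall>t\<ge>3. f (x t) - min_value K f
          \<le> 2 * \<beta> * (diameter S)\<^sup>2 / (real t + 1)
            + 8 * \<beta>\<^sup>2 / \<alpha>
                * ((diameter S)\<^sup>2
                   + min (2 / \<alpha> * (f (x 1) - min_value K f)) ((level_diameter K f (x 1))\<^sup>2))
                * ln (real t) / (real t)\<^sup>2))"
proof -
  interpret nep_run K f \<beta> S x
    using assms by unfold_locales
  define L where "L = level_diameter K f (x 1)"
  have dL: "(d t)\<^sup>2 \<le> L\<^sup>2" if "t \<ge> 1" for t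
    using d_le_level_diameter[OF that] unfolding L_def by (intro power_mono) (auto simp: infdist_nonneg)
  have first: "h t \<le> 2 * \<beta> * (D\<^sup>2 + L\<^sup>2) / (real t + 1)" if "t \<ge> 2" for t
  proof (rule frank_wolfe_rate[OF _ _ _ that])
    fix s :: nat assume s: "s \<ge> 1"
    have "D\<^sup>2 / 2 + (d s)\<^sup>2 \<le> D\<^sup>2 + L\<^sup>2" using dL[OF s] by (simp add: add_mono)
    then have "\<beta> * (2 / (real s + 1))\<^sup>2 / 2 * (D\<^sup>2 / 2 + (d s)\<^sup>2)
        \<le> \<beta> * (2 / (real s + 1))\<^sup>2 / 2 * (D\<^sup>2 + L\<^sup>2)"
      using beta_pos by (intro mult_left_mono) auto
    then show "h (Suc s) \<le> (1 - 2 / (real s + 1)) * h s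
        + \<beta> * (2 / (real s + 1))\<^sup>2 / 2 * (D\<^sup>2 + L\<^sup>2)"
      using progress[OF s] by linarith
  qed (use beta_pos in auto)
  \<comment> \<open>At \<open>t = 2\<close> the binary logarithm is 1 and the denominator is 4, so
    that case is stated without a logarithm and follows from the first-step bound.\<close>
  have second: "(t = 2 \<longrightarrow> h t \<le> 2 * \<beta> * D\<^sup>2 / (real t + 1) + 8 * \<beta>\<^sup>2 / \<alpha> * (D\<^sup>2 + A) / 4) \<and>
      (t \<ge> 3 \<longrightarrow> h t \<le> 2 * \<beta> * D\<^sup>2 / (real t + 1) + 8 * \<beta>\<^sup>2 / \<alpha> * (D\<^sup>2 + A) * ln t / (real t)\<^sup>2)"
    if qg: "quadratic_growth K \<alpha> f" and A: "A = min (2 / \<alpha> * h 1) (L\<^sup>2)" for \<alpha> A t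
  proof -
    have \<alpha>: "\<alpha> > 0" using qg unfolding quadratic_growth_def by simp
    have growth: "(d s)\<^sup>2 \<le> 2 / \<alpha> * h s" if "s \<ge> 1" for s
      using qg x_mem[OF that] unfolding quadratic_growth_def by blast
    have dA: "(d s)\<^sup>2 \<le> A" if "s \<ge> 1" for s
    proof -
      have "2 / \<alpha> * h s \<le> 2 / \<alpha> * h 1"
        using f_le_initial[OF that] \<alpha> by (intro mult_left_mono) auto
      then show ?thesis using growth[OF that] dL[OF that] A by simp
    qed
    have "2 * \<beta>\<^sup>2 / \<alpha> * (D\<^sup>2 + (d 1)\<^sup>2) \<le> 2 * \<beta>\<^sup>2 / \<alpha> * (D\<^sup>2 + A)"
      using dA[of 1] \<alpha> by (intro mult_left_mono) auto
    then have h2: "h 2 \<le> \<beta> * (D\<^sup>2 / 2) + 2 * \<beta>\<^sup>2 / \<alpha> * (2 * (D\<^sup>2 / 2) + A)"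
      using first_step_growth[OF qg] by simp
    have "A \<ge> 0" using dA[of 1] zero_le_power2[of "d 1"] by linarith
    note rate = frank_wolfe_growth_rate[where h = h and d = "\<lambda>s. (d s)\<^sup>2",
        OF beta_pos \<alpha> _ this progress dA growth h2]
    have "\<beta> * (D\<^sup>2 / 2) \<le> 2 * \<beta> * D\<^sup>2 / 3" using beta_pos by simp
    then show ?thesis using h2 rate[of t] by auto
  qed
  show ?thesis
  proof (intro conjI allI impI)
    fix t :: nat assume "t \<ge> 2"
    then show "h t \<le> 2 * \<beta> * (D\<^sup>2 + (level_diameter K f (x 1))\<^sup>2) / (real t + 1)"
      using first L_def by simp
  next
    fix \<alpha> and t :: nat assume qg: "quadratic_growth K \<alpha> f" and "t \<ge> 3"
    then show "h t \<le> 2 * \<beta> * D\<^sup>2 / (real t + 1) + 8 * \<beta>\<^sup>2 / \<alpha>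
        * (D\<^sup>2 + min (2 / \<alpha> * h 1) ((level_diameter K f (x 1))\<^sup>2)) * ln (real t) / (real t)\<^sup>2"
      using second[OF qg refl] L_def by simp
  next
    fix \<alpha> and t :: nat assume qg: "quadratic_growth K \<alpha> f" and t: "t \<ge> 2"
    define A where "A = min (2 / \<alpha> * h 1) (L\<^sup>2)"
    define C where "C = 8 * \<beta>\<^sup>2 / \<alpha> * (D\<^sup>2 + A)"
    have "C \<ge> 0"
      using qg h_nonneg[of 1] unfolding C_def A_def quadratic_growth_def by simp
    have "h t \<le> 2 * \<beta> * D\<^sup>2 / (real t + 1) + C * log 2 t / (real t)\<^sup>2"
    proof (cases "t = 2")
      case True
      then show ?thesis using second[OF qg A_def, of t] by (simp add: C_def)
    next
      case False
      \<comment> \<open>Beyond \<open>t = 2\<close> the binary version is the weaker one, as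
        \<open>ln 2 < 1\<close>.\<close>
      have "ln t \<le> log 2 t"
      proof -
        have "ln t * ln 2 \<le> ln t * 1" using t ln_2_less_1 by (intro mult_left_mono) auto
        then show ?thesis by (simp add: log_def field_simps)
      qed
      then have "C * ln t / (real t)\<^sup>2 \<le> C * log 2 t / (real t)\<^sup>2"
        using \<open>C \<ge> 0\<close> by (intro divide_right_mono mult_left_mono) auto
      then show ?thesis using second[OF qg A_def, of t] False t unfolding C_def by simp
    qed
    then show "h t \<le> 2 * \<beta> * D\<^sup>2 / (real t + 1) + 8 * \<beta>\<^sup>2 / \<alpha>
        * (D\<^sup>2 + min (2 / \<alpha> * h 1) ((level_diameter K f (x 1))\<^sup>2)) * log 2 (real t) / (real t)\<^sup>2"
      by (simp add: C_def A_def L_def)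
  qed
qed

end
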